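(* Let $\Omega \subset \mathbb{R}^n$ be an open, bounded, connected domain with $C^2$ boundary. Let $p \in (1,2]$, let $f \in C^1(\overline{\Omega})$ be semiconcave in $\Omega$, and let $H(x,\beta) = |\beta|^p - f(x)$ for $(x,\beta)\in\overline{\Omega}\times\mathbb{R}^n$. Assume (1) $f(x) = \min_{y\in \overline{\Omega}}f(y)$ for all $x \in \partial \Omega$; (2) $f(x) > \min_{y\in \overline{\Omega}}f(y)$ for all $x \in \Omega$; (3) there exists a constant $C>0$ such that $|Df(x)| \leq C \left(f(x)-\min_{y\in \overline{\Omega}}f(y)\right)^{1/p}$ for all $x \in \Omega$. Then there is a constant $\tilde{C}$ such that the constrained viscosity solution $u$ of $$u+H(x,Du)\le 0 \ \text{ in } \Omega,\qquad u+H(x,Du)\ge 0\ \text{ on } \overline{\Omega}$$ satisfies, in the viscosity sense, $$-D^2u \geq -\tilde{C}\, \mathrm{I}_n \quad \text{in } \Omega,$$ where $\mathrm{I}_n$ is the $n\times n$ identity matrix.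
   Context: Semiconcavity: a function $g$ is semiconcave in an open set $\Omega$ if there is a constant $K\ge 0$ with $g(x+h)+g(x-h)-2g(x)\le K|h|^2$ for all $x,h\in\mathbb{R}^n$ such that the segment $[x-h,x+h]=\{x+sh:-1\le s\le 1\}$ is contained in $\Omega$. Constrained viscosity solution: a function $u\in C(\overline{\Omega})$ is the constrained viscosity solution of $u+H(x,Du)\le 0$ in $\Omega$, $u+H(x,Du)\ge 0$ on $\overline{\Omega}$ if (i) (subsolution in $\Omega$) whenever $\phi$ is a $C^1$ function and $u-\phi$ has a local maximum at $x_0\in\Omega$, then $u(x_0)+H(x_0,D\phi(x_0))\le 0$; and (ii) (supersolution on $\overline{\Omega}$) whenever $\phi\in C^1(\overline{\Omega})$ and $u-\phi$ has a local minimum relative to $\overline{\Omega}$ at $x_0\in\overline{\Omega}$ (boundary points allowed), then $u(x_0)+H(x_0,D\phi(x_0))\ge 0$. Under the present hypotheses it exists and is unique. Viscosity inequality: $-D^2u\ge -\tilde{C}\,\mathrm{I}_n$ in $\Omega$ in the viscosity sense means that whenever $\phi$ is a smooth function in $\Omega$ such that $u-\phi$ has a local minimum at $x\in\Omega$, one has $D^2\phi(x)\le\tilde{C}\,\mathrm{I}_n$ (in the sense of symmetric matrices). *)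

theory Defs
  imports "HOL-Analysis.Analysis"
begin

definition grad :: "(real^'n \<Rightarrow> real) \<Rightarrow> real^'n \<Rightarrow> real^'n" where
  "grad f x = (THE D. GDERIV f x :> D)"

lemma grad_eqI:
  assumes "GDERIV f x :> D"
  shows "grad f x = D"
  unfolding grad_def
proof (rule the_equality)
  show "GDERIV f x :> D" by (rule assms)
next
  fix E assume "GDERIV f x :> E"
  then have "(\<lambda>h. inner h E) = (\<lambda>h. inner h D)"
    using assms unfolding gderiv_def by (rule has_derivative_unique)
  then have "\<And>h. inner h E = inner h D" by (rule fun_cong)
  then show "E = D" by (metis vector_eq_ldot)
qed

definition hessian :: "(real^'n \<Rightarrow> real) \<Rightarrow> real^'n \<Rightarrow> real^'n^'n" where
  "hessian f x = jacobian (grad f) (at x)"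

text \<open>\<open>C^k\<close> on an open set: \<open>f\<close> is differentiable and all its partial derivatives are \<open>C^(k-1)\<close>.\<close>

primrec Ck_on :: "nat \<Rightarrow> (real^'n) set \<Rightarrow> (real^'n \<Rightarrow> real) \<Rightarrow> bool" where
  "Ck_on 0 S f \<longleftrightarrow> continuous_on S f"
| "Ck_on (Suc k) S f \<longleftrightarrow>
     (\<forall>x\<in>S. GDERIV f x :> grad f x) \<and> (\<forall>i. Ck_on k S (\<lambda>x. grad f x $ i))"

definition smooth_on :: "(real^'n) set \<Rightarrow> (real^'n \<Rightarrow> real) \<Rightarrow> bool" where
  "smooth_on S f \<longleftrightarrow> (\<forall>k. Ck_on k S f)"

text \<open>\<open>f\<close> is \<open>C^1\<close> on the closure of the open set \<open>\<Omega>\<close>: it is continuous there, and its gradient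
  in \<open>\<Omega>\<close> extends continuously to the closure. The extension \<open>Df\<close> is determined by \<open>f\<close>
  on \<open>closure \<Omega>\<close>; its values at boundary points are what \<open>Df\<close> means there.\<close>

definition C1_closure ::
    "(real^'n) set \<Rightarrow> (real^'n \<Rightarrow> real) \<Rightarrow> (real^'n \<Rightarrow> real^'n) \<Rightarrow> bool" where
  "C1_closure \<Omega> f Df \<longleftrightarrow>
     continuous_on (closure \<Omega>) f \<and> continuous_on (closure \<Omega>) Df \<and> (\<forall>x\<in>\<Omega>. GDERIV f x :> Df x)"

text \<open>Near each boundary point the set is, after a rotation of the axes, the strict epigraph of a
  \<open>C^2\<close> function \<open>\<gamma>\<close> of the first \<open>n - 1\<close> coordinates. Here \<open>e\<close> is the direction of the
  last axis, and a function of the other coordinates is a function on the whole space that is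
  invariant under translation along \<open>e\<close>; for \<open>n = 1\<close> it is a constant.\<close>

definition C2_boundary :: "(real^'n) set \<Rightarrow> bool" where
  "C2_boundary \<Omega> \<longleftrightarrow>
     (\<forall>x0\<in>frontier \<Omega>. \<exists>r>0. \<exists>e \<gamma>.
        norm e = 1 \<and> Ck_on 2 UNIV \<gamma> \<and> (\<forall>y t. \<gamma> (y + t *\<^sub>R e) = \<gamma> y) \<and>
        \<Omega> \<inter> ball x0 r = {x \<in> ball x0 r. x \<bullet> e > \<gamma> x})"

definition semiconcave_in :: "(real^'n) set \<Rightarrow> (real^'n \<Rightarrow> real) \<Rightarrow> bool" where
  "semiconcave_in \<Omega> g \<longleftrightarrow>
     (\<exists>K\<ge>0. \<forall>x h. closed_segment (x - h) (x + h) \<subseteq> \<Omega> \<longrightarrow>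
        g (x + h) + g (x - h) - 2 * g x \<le> K * (norm h)\<^sup>2)"

definition local_max_rel :: "(real^'n) set \<Rightarrow> (real^'n \<Rightarrow> real) \<Rightarrow> real^'n \<Rightarrow> bool" where
  "local_max_rel S g x \<longleftrightarrow> (\<exists>r>0. \<forall>y \<in> S \<inter> ball x r. g y \<le> g x)"

definition local_min_rel :: "(real^'n) set \<Rightarrow> (real^'n \<Rightarrow> real) \<Rightarrow> real^'n \<Rightarrow> bool" where
  "local_min_rel S g x \<longleftrightarrow> (\<exists>r>0. \<forall>y \<in> S \<inter> ball x r. g x \<le> g y)"

definition visc_subsolution_in ::
    "(real^'n) set \<Rightarrow> (real^'n \<Rightarrow> real^'n \<Rightarrow> real) \<Rightarrow> (real^'n \<Rightarrow> real) \<Rightarrow> bool" where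
  "visc_subsolution_in \<Omega> H u \<longleftrightarrow>
     (\<forall>\<phi>. Ck_on 1 \<Omega> \<phi> \<longrightarrow>
        (\<forall>x0\<in>\<Omega>. local_max_rel \<Omega> (\<lambda>y. u y - \<phi> y) x0 \<longrightarrow>
           u x0 + H x0 (grad \<phi> x0) \<le> 0))"

definition visc_supersolution_closure ::
    "(real^'n) set \<Rightarrow> (real^'n \<Rightarrow> real^'n \<Rightarrow> real) \<Rightarrow> (real^'n \<Rightarrow> real) \<Rightarrow> bool" where
  "visc_supersolution_closure \<Omega> H u \<longleftrightarrow>
     (\<forall>\<phi> D\<phi>. C1_closure \<Omega> \<phi> D\<phi> \<longrightarrow>
        (\<forall>x0\<in>closure \<Omega>. local_min_rel (closure \<Omega>) (\<lambda>y. u y - \<phi> y) x0 \<longrightarrow>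
           u x0 + H x0 (D\<phi> x0) \<ge> 0))"

definition constrained_visc_solution ::
    "(real^'n) set \<Rightarrow> (real^'n \<Rightarrow> real^'n \<Rightarrow> real) \<Rightarrow> (real^'n \<Rightarrow> real) \<Rightarrow> bool" where
  "constrained_visc_solution \<Omega> H u \<longleftrightarrow>
     continuous_on (closure \<Omega>) u \<and> visc_subsolution_in \<Omega> H u \<and> visc_supersolution_closure \<Omega> H u"

definition matrix_le :: "real^'n^'n \<Rightarrow> real^'n^'n \<Rightarrow> bool" where
  "matrix_le A B \<longleftrightarrow> (\<forall>v. v \<bullet> (A *v v) \<le> v \<bullet> (B *v v))"

definition visc_hessian_le ::
    "(real^'n) set \<Rightarrow> (real^'n \<Rightarrow> real) \<Rightarrow> real \<Rightarrow> bool" where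
  "visc_hessian_le \<Omega> u C \<longleftrightarrow>
     (\<forall>\<phi>. smooth_on \<Omega> \<phi> \<longrightarrow>
        (\<forall>x\<in>\<Omega>. local_min_rel \<Omega> (\<lambda>y. u y - \<phi> y) x \<longrightarrow>
           matrix_le (hessian \<phi> x) (C *\<^sub>R mat 1)))"

end

(* With m = min f and g = f - m, every solution satisfies m <= u <= f. Condition (3) makes
   g^(1 - 1/p) Lipschitz with value 0 on the boundary, so g <= C dist^(p/(p-1)) there, and
   p/(p-1) >= 2 because p <= 2. Hence, whenever the segment [x - h, x + h] leaves the domain,
   u(x + h) + u(x - h) - 2 u(x) <= g(x + h) + g(x - h) <= K |h|^2 for free. A positive maximum of
   u(x + h) + u(x - h) - 2 u(x) - K |h|^2 is therefore attained with the segment inside the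
   domain, where tripling of variables and the semiconcavity of f exclude it. *)

theory Submission
  imports Defs
begin

section \<open>Midpoint convexity of the Hamiltonian and quadratic test functions\<close>

text \<open>The triangle inequality and monotonicity of \<open>powr\<close> reduce the claim to
  nonnegative reals. There convexity is applied on the open half line, and an argument equal to 0 is
  covered by \<open>half\<close>, which amounts to \<open>2 powr p\<close> being at least 2.\<close>

lemma midpoint_convex_norm_powr:
  fixes a b :: "'a::real_normed_vector"
  assumes "1 \<le> p"
  shows "2 * norm ((1/2) *\<^sub>R (a + b)) powr p \<le> norm a powr p + norm b powr p"
proof -
  have half: "2 * (t / 2) powr p \<le> t powr p" if "0 \<le> t" for t :: real
  proof -
    have "(2::real) powr 1 \<le> 2 powr p"
      using assms by (intro powr_mono) auto
    then have "t powr p * 2 \<le> t powr p * 2 powr p"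
      by (intro mult_left_mono) auto
    then show ?thesis
      using that by (simp add: powr_divide field_simps)
  qed
  have real_case: "2 * ((s + t) / 2) powr p \<le> s powr p + t powr p"
    if "0 \<le> s" "0 \<le> t" for s t :: real
  proof (cases "s = 0 \<or> t = 0")
    case True
    then show ?thesis using half[OF that(1)] half[OF that(2)] assms by auto
  next
    case False
    then have "s \<in> {0<..}" "t \<in> {0<..}" using that by auto
    then show ?thesis
      using convex_onD[OF powr_convex[OF assms], of "1/2" s t]
      by (simp add: field_simps)
  qed
  have "norm ((1/2) *\<^sub>R (a + b)) \<le> (norm a + norm b) / 2"
    using norm_triangle_ineq[of a b] by simp
  then have "norm ((1/2) *\<^sub>R (a + b)) powr p \<le> ((norm a + norm b) / 2) powr p"
    using assms by (intro powr_mono2) auto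
  then show ?thesis using real_case[of "norm a" "norm b"] by simp
qed

text \<open>Every test function for \<open>u\<close> below has this shape. When two of the three
  variables of the tripling are frozen, each of the two penalties becomes one square in the
  remaining variable; zero coefficients give single squares and constants.\<close>

lemma GDERIV_sum_of_squares:
  "GDERIV (\<lambda>y. a * (norm (y + b))\<^sup>2 + c * (norm (y + d))\<^sup>2) x :>
     (2 * a) *\<^sub>R (x + b) + (2 * c) *\<^sub>R (x + d)"
  unfolding gderiv_def power2_norm_eq_inner
  by (rule derivative_eq_intros refl | simp add: algebra_simps inner_commute fun_eq_iff)+

lemma visc_subsolution_sum_of_squares:
  fixes \<Omega> :: "(real^'n) set"
  assumes "visc_subsolution_in \<Omega> H u" "x \<in> \<Omega>"
    and "local_max_rel \<Omega> (\<lambda>y. u y - (a * (norm (y + b))\<^sup>2 + c * (norm (y + d))\<^sup>2)) x"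
  shows "u x + H x ((2 * a) *\<^sub>R (x + b) + (2 * c) *\<^sub>R (x + d)) \<le> 0"
proof -
  let ?\<phi> = "\<lambda>y. a * (norm (y + b))\<^sup>2 + c * (norm (y + d))\<^sup>2"
  have g: "grad ?\<phi> y = (2 * a) *\<^sub>R (y + b) + (2 * c) *\<^sub>R (y + d)" for y
    by (rule grad_eqI[OF GDERIV_sum_of_squares])
  have "Ck_on 1 \<Omega> ?\<phi>"
    using GDERIV_sum_of_squares[of a b c d]
    by (auto simp: g intro!: continuous_intros)
  then have "u x + H x (grad ?\<phi> x) \<le> 0"
    using assms unfolding visc_subsolution_in_def by blast
  then show ?thesis by (simp add: g)
qed

lemma visc_supersolution_sum_of_squares:
  fixes \<Omega> :: "(real^'n) set"
  assumes "visc_supersolution_closure \<Omega> H u" "x \<in> closure \<Omega>"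
    and "local_min_rel (closure \<Omega>)
           (\<lambda>y. u y - (a * (norm (y + b))\<^sup>2 + c * (norm (y + d))\<^sup>2)) x"
  shows "0 \<le> u x + H x ((2 * a) *\<^sub>R (x + b) + (2 * c) *\<^sub>R (x + d))"
proof -
  let ?\<phi> = "\<lambda>y. a * (norm (y + b))\<^sup>2 + c * (norm (y + d))\<^sup>2"
  have "C1_closure \<Omega> ?\<phi> (\<lambda>y. (2 * a) *\<^sub>R (y + b) + (2 * c) *\<^sub>R (y + d))"
    unfolding C1_closure_def
    using GDERIV_sum_of_squares[of a b c d] by (auto intro!: continuous_intros)
  from assms(1)[unfolded visc_supersolution_closure_def, rule_format, OF this assms(2,3)]
  show ?thesis .
qed

section \<open>A priori bounds for solutions\<close>

text \<open>Wherever a quadratic touches \<open>u\<close> from above, the equation yields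
  \<open>u \<le> - H \<le> f\<close>, whatever the gradient is. If \<open>u\<close> exceeded
  \<open>f\<close> at \<open>x0\<close>, a steep paraboloid centred at \<open>x0\<close> would touch
  \<open>u\<close> at a nearby point \<open>y\<close> with
  \<open>u y \<ge> u x0 > f y\<close>.\<close>

lemma visc_subsolution_le:
  fixes \<Omega> :: "(real^'n) set"
  assumes "open \<Omega>" and u: "continuous_on (closure \<Omega>) u" and f: "continuous_on (closure \<Omega>) f"
    and sub: "visc_subsolution_in \<Omega> H u"
    and H: "\<And>x \<beta>. x \<in> closure \<Omega> \<Longrightarrow> H x \<beta> \<ge> - f x"
    and "x \<in> closure \<Omega>"
  shows "u x \<le> f x"
proof -
  have int: "u x0 \<le> f x0" if x0: "x0 \<in> \<Omega>" for x0
  proof (rule ccontr)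
    assume "\<not> u x0 \<le> f x0"
    have "isCont u x0" "isCont f x0"
      using that assms(1) closure_subset[of \<Omega>] u f
      by (meson continuous_on_eq_continuous_at continuous_on_subset)+
    then have "((\<lambda>y. u x0 - f y) \<longlongrightarrow> u x0 - f x0) (at x0)"
      by (intro tendsto_intros) (auto simp: isCont_def)
    then have "eventually (\<lambda>y. 0 < u x0 - f y) (at x0)"
      using \<open>\<not> u x0 \<le> f x0\<close> by (intro order_tendstoD(1)) auto
    then have "\<exists>r>0. \<forall>y. y \<noteq> x0 \<and> dist y x0 < r \<longrightarrow> f y < u x0"
      unfolding eventually_at by simp
    then obtain r1 where r1: "r1 > 0" "\<And>y. y \<noteq> x0 \<Longrightarrow> dist y x0 < r1 \<Longrightarrow> f y < u x0"
      by blast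
    obtain r2 where r2: "r2 > 0" "ball x0 r2 \<subseteq> \<Omega>"
      using openE[OF assms(1) x0] by metis
    define r where "r = min r1 r2 / 2"
    have r: "r > 0" "cball x0 r \<subseteq> \<Omega>" "\<And>y. y \<in> cball x0 r \<Longrightarrow> f y < u x0"
    proof -
      show "r > 0" using r1 r2 by (simp add: r_def)
      have "cball x0 r \<subseteq> ball x0 r2" using r1 r2 by (auto simp: r_def)
      then show "cball x0 r \<subseteq> \<Omega>" using r2 by blast
      fix y assume "y \<in> cball x0 r"
      then have "dist y x0 < r1" using r1 r2 by (auto simp: r_def dist_commute)
      then show "f y < u x0" using r1(2)[of y] \<open>\<not> u x0 \<le> f x0\<close> by (cases "y = x0") auto
    qed
    have cu: "continuous_on (cball x0 r) u"
      using u r(2) closure_subset continuous_on_subset by (metis order_trans)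
    obtain ym where ym: "\<And>y. y \<in> cball x0 r \<Longrightarrow> u y \<le> u ym"
      using continuous_attains_sup[OF compact_cball _ cu] r(1) by fastforce
    \<comment> \<open>On the sphere of radius \<open>r\<close> the penalty
      \<open>k * r\<^sup>2\<close> exceeds the largest possible gain \<open>u ym - u x0\<close> by
      1, so the penalised maximum over the closed ball lies in its interior.\<close>
    define k where "k = (u ym - u x0 + 1) / r\<^sup>2"
    have kr: "k * r\<^sup>2 = u ym - u x0 + 1" using r(1) by (simp add: k_def)
    have "0 \<le> u ym - u x0" using ym[of x0] r(1) by simp
    then have "k \<ge> 0" by (simp add: k_def)
    let ?\<phi> = "\<lambda>y. k * (norm (y + (- x0)))\<^sup>2 + 0 * (norm (y + 0))\<^sup>2"
    have "continuous_on (cball x0 r) (\<lambda>y. u y - ?\<phi> y)"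
      by (intro continuous_intros cu)
    then obtain y where y: "y \<in> cball x0 r"
        "\<And>z. z \<in> cball x0 r \<Longrightarrow> u z - ?\<phi> z \<le> u y - ?\<phi> y"
      using continuous_attains_sup[OF compact_cball, of x0 r] r(1) by fastforce
    have y0: "u x0 \<le> u y - k * (norm (y - x0))\<^sup>2"
      using y(2)[of x0] r(1) by simp
    have "dist x0 y \<noteq> r"
    proof
      assume "dist x0 y = r"
      then have "norm (y - x0) = r" by (simp add: dist_norm norm_minus_commute)
      then show False using y0 kr ym[OF y(1)] by simp
    qed
    then have r': "0 < r - dist x0 y" using y(1) by simp
    have "local_max_rel \<Omega> (\<lambda>z. u z - ?\<phi> z) y"
      unfolding local_max_rel_def
    proof (intro exI conjI ballI)
      fix z assume "z \<in> \<Omega> \<inter> ball y (r - dist x0 y)"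
      then have "z \<in> cball x0 r" using dist_triangle[of x0 z y] by simp
      then show "u z - ?\<phi> z \<le> u y - ?\<phi> y" by (rule y(2))
    qed (use r' in auto)
    then have "u y + H y ((2 * k) *\<^sub>R (y + (- x0)) + (2 * 0) *\<^sub>R (y + 0)) \<le> 0"
      using y(1) r(2) by (intro visc_subsolution_sum_of_squares[OF sub]) auto
    moreover have "y \<in> closure \<Omega>" using y(1) r(2) closure_subset by blast
    ultimately have "u y \<le> f y" using H[of y] by (smt (verit))
    moreover have "u x0 \<le> u y" using y0 \<open>k \<ge> 0\<close> by (smt (verit) mult_nonneg_nonneg zero_le_power2)
    ultimately show False using r(3)[OF y(1)] by simp
  qed
  \<comment> \<open>A subsolution is tested at interior points only; the boundary is reached by
    density and continuity.\<close>
  have "closed {x \<in> closure \<Omega>. u x \<le> f x}"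
    by (intro continuous_on_closed_Collect_le u f closed_closure)
  then have "closure \<Omega> \<subseteq> {x \<in> closure \<Omega>. u x \<le> f x}"
    using int closure_subset by (intro closure_minimal) auto
  then show ?thesis using assms(6) by blast
qed

text \<open>A constant is tested at a global minimum point of \<open>u\<close>. That point may lie
  on the boundary, where the supersolution property still holds because of the constraint.\<close>

lemma visc_supersolution_ge:
  fixes \<Omega> :: "(real^'n) set"
  assumes "bounded \<Omega>" and u: "continuous_on (closure \<Omega>) u"
    and super: "visc_supersolution_closure \<Omega> H u"
    and H: "\<And>x. x \<in> closure \<Omega> \<Longrightarrow> H x 0 \<le> - m"
    and "x \<in> closure \<Omega>"
  shows "m \<le> u x"
proof -
  have "compact (closure \<Omega>)" "closure \<Omega> \<noteq> {}" using assms(1,5) by auto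
  from continuous_attains_inf[OF this u] obtain y where y: "y \<in> closure \<Omega>" "\<And>z. z \<in> closure \<Omega> \<Longrightarrow> u y \<le> u z"
    by blast
  have "local_min_rel (closure \<Omega>) (\<lambda>z. u z - (0 * (norm (z + 0))\<^sup>2 + 0 * (norm (z + 0))\<^sup>2)) y"
    unfolding local_min_rel_def using y by (intro exI[of _ 1]) auto
  from visc_supersolution_sum_of_squares[OF super y(1) this] have "0 \<le> u y + H y 0" by simp
  then show ?thesis using H[OF y(1)] y(2)[OF assms(5)] by simp
qed

section \<open>Decay of \<open>f\<close> to its minimum at the boundary\<close>

text \<open>With \<open>s = 1 - 1 / p\<close>, the gradient of \<open>g powr s\<close> is
  \<open>s * g powr (- 1 / p)\<close> times \<open>Dg\<close>, so the bound on \<open>Dg\<close>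
  makes its norm at most \<open>C\<close>. The mean value theorem is applied on the segment from
  \<open>x\<close> to a nearest point of the complement, where \<open>g\<close> vanishes.\<close>

lemma powr_le_dist_complement:
  fixes \<Omega> :: "'a::euclidean_space set"
  assumes "open \<Omega>" "1 < p" "0 < C"
    and g: "continuous_on (closure \<Omega>) g" and D: "\<And>x. x \<in> \<Omega> \<Longrightarrow> GDERIV g x :> Dg x"
    and pos: "\<And>x. x \<in> \<Omega> \<Longrightarrow> 0 < g x" and zero: "\<And>x. x \<in> frontier \<Omega> \<Longrightarrow> g x = 0"
    and bound: "\<And>x. x \<in> \<Omega> \<Longrightarrow> norm (Dg x) \<le> C * g x powr (1 / p)"
    and x: "x \<in> \<Omega>" and w: "w \<notin> \<Omega>"
  shows "g x powr (1 - 1 / p) \<le> C * dist x w"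
proof -
  have "closed (- \<Omega>)" "- \<Omega> \<noteq> {}" using assms(1) w by auto
  \<comment> \<open>The segment from \<open>x\<close> to \<open>w\<close> may leave
    \<open>\<Omega>\<close> and reenter it. The segment to a nearest point \<open>a\<close> stays
    inside until its endpoint, and \<open>dist x a \<le> dist x w\<close>.\<close>
  then obtain a where a: "a \<in> - \<Omega>" "\<And>y. y \<in> - \<Omega> \<Longrightarrow> dist x a \<le> dist x y"
    using distance_attains_inf[of "- \<Omega>" x] by metis
  have "x \<noteq> a" using a x by auto
  define \<gamma> where "\<gamma> t = x + t *\<^sub>R (a - x)" for t :: real
  have in\<Omega>: "\<gamma> t \<in> \<Omega>" if "0 \<le> t" "t < 1" for t
  proof (rule ccontr)
    assume "\<gamma> t \<notin> \<Omega>"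
    then have "dist x a \<le> dist x (\<gamma> t)" using a by simp
    also have "\<dots> = t * dist x a"
      using that by (simp add: \<gamma>_def dist_norm norm_minus_commute)
    finally show False using that \<open>x \<noteq> a\<close> by simp
  qed
  have "a \<in> closure \<Omega>"
  proof -
    have "open_segment x a \<subseteq> \<Omega>"
    proof
      fix y assume "y \<in> open_segment x a"
      then obtain t where t: "0 < t" "t < 1" "y = (1 - t) *\<^sub>R x + t *\<^sub>R a"
        by (auto simp: in_segment)
      then have "y = \<gamma> t" by (simp add: \<gamma>_def algebra_simps)
      then show "y \<in> \<Omega>" using in\<Omega> t by simp
    qed
    then have "closure (open_segment x a) \<subseteq> closure \<Omega>" by (rule closure_mono)
    then show ?thesis using \<open>x \<noteq> a\<close> by auto
  qed
  then have ga: "g a = 0"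
    using a assms(1) zero[of a] by (simp add: frontier_def interior_open)
  have \<gamma>cl: "\<gamma> t \<in> closure \<Omega>" if "0 \<le> t" "t \<le> 1" for t
    using in\<Omega>[of t] that closure_subset[of \<Omega>] \<open>a \<in> closure \<Omega>\<close>
    by (cases "t = 1") (auto simp: \<gamma>_def)
  have gnn: "0 \<le> g y" if "y \<in> closure \<Omega>" for y
    using that pos[of y] zero[of y] assms(1)
    by (cases "y \<in> \<Omega>") (auto simp: frontier_def interior_open)
  define s where "s = 1 - 1 / p"
  have s: "0 < s" "s < 1" using assms(2) by (auto simp: s_def)
  define d where "d y = g y powr s" for y
  have "continuous_on {0..1} (\<lambda>t. g (\<gamma> t))"
    using \<gamma>cl unfolding \<gamma>_def
    by (intro continuous_on_compose2[OF g] continuous_intros) auto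
  then have cont: "continuous_on {0..1} (\<lambda>t. d (\<gamma> t))"
    unfolding d_def using s gnn \<gamma>cl by (intro continuous_on_powr' continuous_on_const) auto
  have der: "((\<lambda>t. d (\<gamma> t)) has_derivative
      (\<lambda>h. h * (s * g (\<gamma> t) powr (s - 1) * ((a - x) \<bullet> Dg (\<gamma> t))))) (at t)"
    if "0 < t" "t < 1" for t
  proof -
    have 1: "(\<gamma> has_derivative (\<lambda>h. h *\<^sub>R (a - x))) (at t)"
      unfolding \<gamma>_def by (rule derivative_eq_intros refl | simp)+
    have 2: "(g has_derivative (\<lambda>h. h \<bullet> Dg (\<gamma> t))) (at (\<gamma> t))"
      using D[OF in\<Omega>] that unfolding gderiv_def by auto
    have 3: "((\<lambda>y. y powr s) has_derivative (\<lambda>h. h * (s * g (\<gamma> t) powr (s - 1)))) (at ((g \<circ> \<gamma>) t))"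
      using has_real_derivative_powr[OF pos[OF in\<Omega>], of t s] that
      by (simp add: has_field_derivative_def mult_commute_abs)
    have "((\<lambda>t. (g (\<gamma> t)) powr s) has_derivative
       (\<lambda>h. ((h *\<^sub>R (a - x)) \<bullet> Dg (\<gamma> t)) * (s * g (\<gamma> t) powr (s - 1)))) (at t)"
      using diff_chain_at[OF diff_chain_at[OF 1 2] 3] by (simp add: o_def)
    then show ?thesis by (simp add: d_def mult_ac)
  qed
  \<comment> \<open>Differentiability is asked for on the open interval only. At
    \<open>t = 1\<close> the function \<open>g\<close> vanishes, where the power with exponent
    \<open>s < 1\<close> is singular.\<close>
  obtain t where t: "0 < t" "t < 1" and
    le: "norm (d (\<gamma> 1) - d (\<gamma> 0)) \<le>
      norm ((1 - 0) * (s * g (\<gamma> t) powr (s - 1) * ((a - x) \<bullet> Dg (\<gamma> t))))"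
    using mvt_general[OF zero_less_one cont der] by auto
  have "d (\<gamma> 1) = 0" "d (\<gamma> 0) = g x powr s"
    using ga by (auto simp: d_def \<gamma>_def)
  then have "g x powr s \<le> \<bar>s * g (\<gamma> t) powr (s - 1) * ((a - x) \<bullet> Dg (\<gamma> t))\<bar>"
    using le by simp
  also have "\<dots> = s * g (\<gamma> t) powr (s - 1) * \<bar>(a - x) \<bullet> Dg (\<gamma> t)\<bar>"
    using s by (simp add: abs_mult)
  also have "\<dots> \<le> 1 * g (\<gamma> t) powr (s - 1) * (dist x a * (C * g (\<gamma> t) powr (1 / p)))"
  proof (intro mult_mono)
    have "\<bar>(a - x) \<bullet> Dg (\<gamma> t)\<bar> \<le> norm (a - x) * norm (Dg (\<gamma> t))"
      by (rule Cauchy_Schwarz_ineq2)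
    also have "\<dots> \<le> dist x a * (C * g (\<gamma> t) powr (1 / p))"
      using bound[OF in\<Omega>] t by (intro mult_mono) (auto simp: dist_norm norm_minus_commute)
    finally show "\<bar>(a - x) \<bullet> Dg (\<gamma> t)\<bar> \<le> dist x a * (C * g (\<gamma> t) powr (1 / p))" .
  qed (use s in auto)
  also have "\<dots> = C * dist x a"
  proof -
    have "g (\<gamma> t) powr (s - 1) * g (\<gamma> t) powr (1 / p) = g (\<gamma> t) powr 0"
      by (simp only: powr_add[symmetric] s_def) simp
    also have "\<dots> = 1" using pos[OF in\<Omega>, of t] t by simp
    finally show ?thesis by (simp add: mult_ac)
  qed
  also have "\<dots> \<le> C * dist x w" using a(2)[of w] w assms(3) by simp
  finally show ?thesis by (simp add: s_def)
qed

section \<open>Tripling of variables\<close>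

text \<open>In the tripling, the gradient of the test function at \<open>y\<close> is the mean of those at \<open>x\<close>
  and \<open>z\<close>, so the Hamiltonian terms drop out by convexity; the zeroth order term \<open>u\<close> of the
  equation then bounds the second difference of \<open>u\<close> by that of \<open>f\<close>.\<close>

lemma second_difference_le:
  fixes \<Omega> :: "(real^'n) set"
  assumes "open \<Omega>" "bounded \<Omega>"
    and u: "continuous_on (closure \<Omega>) u" and f: "continuous_on (closure \<Omega>) f"
    and sub: "visc_subsolution_in \<Omega> H u" and super: "visc_supersolution_closure \<Omega> H u"
    and H: "\<And>x \<beta>. x \<in> closure \<Omega> \<Longrightarrow> H x \<beta> = G \<beta> - f x"
    and G: "\<And>a b. 2 * G ((1/2) *\<^sub>R (a + b)) \<le> G a + G b"
    and conc: "\<And>x h. closed_segment (x - h) (x + h) \<subseteq> \<Omega> \<Longrightarrow>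
        f (x + h) + f (x - h) - 2 * f x \<le> K * (norm h)\<^sup>2"
    and bdry: "\<And>x h. x \<in> closure \<Omega> \<Longrightarrow> x + h \<in> closure \<Omega> \<Longrightarrow> x - h \<in> closure \<Omega> \<Longrightarrow>
        \<not> closed_segment (x - h) (x + h) \<subseteq> \<Omega> \<Longrightarrow>
        u (x + h) + u (x - h) - 2 * u x \<le> K * (norm h)\<^sup>2"
    and "0 \<le> K"
    and "x \<in> closure \<Omega>" "x + h \<in> closure \<Omega>" "x - h \<in> closure \<Omega>"
  shows "u (x + h) + u (x - h) - 2 * u x \<le> K * (norm h)\<^sup>2"
proof (rule ccontr)
  define M where "M = u (x + h) + u (x - h) - 2 * u x - K * (norm h)\<^sup>2"
  assume "\<not> ?thesis"
  then have M: "M > 0" by (simp add: M_def)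
  define S where "S = closure \<Omega> \<times> closure \<Omega> \<times> closure \<Omega>"
  \<comment> \<open>The first penalty forces \<open>x + z = 2 y\<close> as \<open>k\<close> grows.
    The second equals \<open>K * (norm h)\<^sup>2\<close> when \<open>x - z = 2 h\<close>. At the
    assumed counterexample the first vanishes, so every maximum of \<open>\<Psi> k\<close> is at
    least \<open>M\<close>.\<close>
  define \<Psi> where "\<Psi> k w = (case w of (x, z, y) \<Rightarrow> u x + u z - 2 * u y
      - (real k * (norm (x + z - 2 *\<^sub>R y))\<^sup>2 + K / 4 * (norm (x - z))\<^sup>2))" for k w
  have cS: "compact S" unfolding S_def using assms(2) by (intro compact_Times) auto
  have w0: "(x + h, x - h, x) \<in> S" using assms by (simp add: S_def)
  have norm2: "K / 4 * (norm (h + h))\<^sup>2 = K * (norm h)\<^sup>2"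
    unfolding scaleR_2[symmetric] by (simp add: power_mult_distrib)
  have \<Psi>0: "\<Psi> k (x + h, x - h, x) = M" for k
    using norm2 by (simp add: \<Psi>_def M_def scaleR_2)
  have cu: "continuous_on S (\<lambda>w. u (fst w))" "continuous_on S (\<lambda>w. u (fst (snd w)))"
    "continuous_on S (\<lambda>w. u (snd (snd w)))"
    "continuous_on S (\<lambda>w. f (fst w))" "continuous_on S (\<lambda>w. f (fst (snd w)))"
    "continuous_on S (\<lambda>w. f (snd (snd w)))"
    by (auto simp: S_def intro!: continuous_on_compose2[OF u] continuous_on_compose2[OF f]
        continuous_intros)
  have "continuous_on S (\<Psi> k)" for k
    unfolding \<Psi>_def case_prod_beta by (intro continuous_intros cu)
  then have "\<exists>w\<in>S. \<forall>v\<in>S. \<Psi> k v \<le> \<Psi> k w" for k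
    using continuous_attains_sup[OF cS] w0 by (metis empty_iff)
  then obtain W where W: "\<And>k. W k \<in> S" "\<And>k v. v \<in> S \<Longrightarrow> \<Psi> k v \<le> \<Psi> k (W k)"
    by metis
  obtain l \<rho> where l: "l \<in> S" "strict_mono \<rho>" "(W \<circ> \<rho>) \<longlonglongrightarrow> l"
    using cS W(1) unfolding compact_def by metis
  define X where "X j = fst (W (\<rho> j))" for j
  define Z where "Z j = fst (snd (W (\<rho> j)))" for j
  define Y where "Y j = snd (snd (W (\<rho> j)))" for j
  have WXZY: "W (\<rho> j) = (X j, Z j, Y j)" for j by (simp add: X_def Y_def Z_def)
  obtain xl zl yl where lx: "l = (xl, zl, yl)" by (cases l)
  have lim: "(\<lambda>j. W (\<rho> j)) \<longlonglongrightarrow> l" using l(3) by (simp add: o_def)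
  have X: "X \<longlonglongrightarrow> xl" using tendsto_fst[OF lim] by (simp add: X_def[abs_def] lx)
  have Z: "Z \<longlonglongrightarrow> zl" using tendsto_fst[OF tendsto_snd[OF lim]] by (simp add: Z_def[abs_def] lx)
  have Y: "Y \<longlonglongrightarrow> yl" using tendsto_snd[OF tendsto_snd[OF lim]] by (simp add: Y_def[abs_def] lx)
  have cl: "X j \<in> closure \<Omega>" "Z j \<in> closure \<Omega>" "Y j \<in> closure \<Omega>" for j
    using W(1)[of "\<rho> j"] by (auto simp: WXZY S_def)
  have cll: "xl \<in> closure \<Omega>" "zl \<in> closure \<Omega>" "yl \<in> closure \<Omega>"
    using l(1) by (auto simp: lx S_def)
  have ulim: "(\<lambda>j. u (X j)) \<longlonglongrightarrow> u xl" "(\<lambda>j. u (Z j)) \<longlonglongrightarrow> u zl" "(\<lambda>j. u (Y j)) \<longlonglongrightarrow> u yl"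
    using cl cll by (auto intro!: continuous_on_tendsto_compose[OF u] X Y Z)
  have flim: "(\<lambda>j. f (X j)) \<longlonglongrightarrow> f xl" "(\<lambda>j. f (Z j)) \<longlonglongrightarrow> f zl" "(\<lambda>j. f (Y j)) \<longlonglongrightarrow> f yl"
    using cl cll by (auto intro!: continuous_on_tendsto_compose[OF f] X Y Z)
  have low: "M + (real (\<rho> j) * (norm (X j + Z j - 2 *\<^sub>R Y j))\<^sup>2 + K / 4 * (norm (X j - Z j))\<^sup>2)
     \<le> u (X j) + u (Z j) - 2 * u (Y j)" for j
    using W(2)[OF w0, of "\<rho> j"] unfolding \<Psi>0 by (simp add: WXZY \<Psi>_def)
  have lowK: "M + K / 4 * (norm (X j - Z j))\<^sup>2 \<le> u (X j) + u (Z j) - 2 * u (Y j)" for j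
  proof -
    have "0 \<le> real (\<rho> j) * (norm (X j + Z j - 2 *\<^sub>R Y j))\<^sup>2" by simp
    then show ?thesis using low[of j] by linarith
  qed
  have lowl: "M + K / 4 * (norm (xl - zl))\<^sup>2 \<le> u xl + u zl - 2 * u yl"
    by (rule tendsto_le[OF _ _ _ always_eventually[OF allI[OF lowK]]])
      (auto intro!: tendsto_intros X Z ulim)
  \<comment> \<open>Otherwise the first penalty would tend to infinity along the subsequence, while
    by \<open>low\<close> it stays below the convergent second differences of
    \<open>u\<close>.\<close>
  have "xl + zl - 2 *\<^sub>R yl = 0"
  proof (rule ccontr)
    assume "xl + zl - 2 *\<^sub>R yl \<noteq> 0"
    then have pos: "0 < (norm (xl + zl - 2 *\<^sub>R yl))\<^sup>2" by simp
    have "(\<lambda>j. (norm (X j + Z j - 2 *\<^sub>R Y j))\<^sup>2) \<longlonglongrightarrow> (norm (xl + zl - 2 *\<^sub>R yl))\<^sup>2"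
      by (intro tendsto_intros X Y Z)
    moreover have "filterlim (\<lambda>j. real (\<rho> j)) at_top sequentially"
      by (rule filterlim_compose[OF filterlim_real_sequentially filterlim_subseq[OF l(2)]])
    ultimately have "filterlim (\<lambda>j. (norm (X j + Z j - 2 *\<^sub>R Y j))\<^sup>2 * real (\<rho> j)) at_top sequentially"
      using pos by (intro filterlim_tendsto_pos_mult_at_top)
    moreover have "(\<lambda>j. u (X j) + u (Z j) - 2 * u (Y j)) \<longlonglongrightarrow> u xl + u zl - 2 * u yl"
      by (intro tendsto_intros ulim)
    then have "eventually (\<lambda>j. u (X j) + u (Z j) - 2 * u (Y j) < u xl + u zl - 2 * u yl + 1) sequentially"
      by (rule order_tendstoD) simp
    ultimately have "eventually (\<lambda>j. u xl + u zl - 2 * u yl + 1 \<le> (norm (X j + Z j - 2 *\<^sub>R Y j))\<^sup>2 * real (\<rho> j)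
        \<and> u (X j) + u (Z j) - 2 * u (Y j) < u xl + u zl - 2 * u yl + 1) sequentially"
      unfolding filterlim_at_top by (intro eventually_conj) blast+
    from eventually_happens[OF this] obtain j where
      "u xl + u zl - 2 * u yl + 1 \<le> (norm (X j + Z j - 2 *\<^sub>R Y j))\<^sup>2 * real (\<rho> j)"
      "u (X j) + u (Z j) - 2 * u (Y j) < u xl + u zl - 2 * u yl + 1"
      by auto
    moreover have "0 \<le> K / 4 * (norm (X j - Z j))\<^sup>2" using \<open>0 \<le> K\<close> by simp
    ultimately show False using low[of j] M by (simp add: mult.commute)
  qed
  define hl where "hl = (1/2) *\<^sub>R (xl - zl)"
  have xzl: "xl = yl + hl" "zl = yl - hl"
  proof -
    have "yl = (1/2) *\<^sub>R (xl + zl)" using \<open>xl + zl - 2 *\<^sub>R yl = 0\<close> by simp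
    then show "xl = yl + hl" "zl = yl - hl"
      by (simp_all add: hl_def flip: scaleR_add_right scaleR_diff_right)
  qed
  have "K / 4 * (norm (xl - zl))\<^sup>2 = K * (norm hl)\<^sup>2"
    by (simp add: hl_def power_divide)
  then have strict: "K * (norm hl)\<^sup>2 < u (yl + hl) + u (yl - hl) - 2 * u yl"
    using lowl M unfolding xzl[symmetric] by linarith
  \<comment> \<open>The limit configuration violates the bound strictly, which \<open>bdry\<close>
    rules out for segments that leave \<open>\<Omega>\<close>. Hence \<open>X j\<close> and
    \<open>Z j\<close> are eventually interior and can be tested as subsolution points;
    \<open>Y j\<close> is tested on the closure.\<close>
  then have seg: "closed_segment (yl - hl) (yl + hl) \<subseteq> \<Omega>"
    using bdry[of yl hl] cll by (auto simp: xzl)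
  then have in\<Omega>: "xl \<in> \<Omega>" "zl \<in> \<Omega>"
    using ends_in_segment by (auto simp: xzl)
  have "eventually (\<lambda>j. X j \<in> \<Omega>) sequentially" "eventually (\<lambda>j. Z j \<in> \<Omega>) sequentially"
    using topological_tendstoD[OF X assms(1) in\<Omega>(1)] topological_tendstoD[OF Z assms(1) in\<Omega>(2)] .
  then have ev: "eventually (\<lambda>j. u (X j) + u (Z j) - 2 * u (Y j) \<le> f (X j) + f (Z j) - 2 * f (Y j))
      sequentially"
  proof eventually_elim
    case (elim j)
    define k where "k = real (\<rho> j)"
    have mx: "u a + u b - 2 * u c - (k * (norm (a + b - 2 *\<^sub>R c))\<^sup>2 + K / 4 * (norm (a - b))\<^sup>2)
      \<le> u (X j) + u (Z j) - 2 * u (Y j)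
        - (k * (norm (X j + Z j - 2 *\<^sub>R Y j))\<^sup>2 + K / 4 * (norm (X j - Z j))\<^sup>2)"
      if "a \<in> closure \<Omega>" "b \<in> closure \<Omega>" "c \<in> closure \<Omega>" for a b c
      using W(2)[of "(a, b, c)" "\<rho> j"] that by (simp add: S_def WXZY \<Psi>_def k_def)
    define \<zeta> where "\<zeta> = X j + Z j - 2 *\<^sub>R Y j"
    \<comment> \<open>These are the gradients of the three test functions. The middle variable
      enters \<open>\<Psi>\<close> through \<open>- 2 * u y\<close>, so a maximum there is a minimum
      for \<open>u\<close>. The coefficient \<open>- 2 * k\<close> arises from \<open>4 * k\<close>,
      by \<open>sq\<close>, after division by \<open>- 2\<close>.\<close>
    define px where "px = (2 * k) *\<^sub>R (X j + (Z j - 2 *\<^sub>R Y j)) + (2 * (K / 4)) *\<^sub>R (X j + (- Z j))"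
    define pz where "pz = (2 * k) *\<^sub>R (Z j + (X j - 2 *\<^sub>R Y j)) + (2 * (K / 4)) *\<^sub>R (Z j + (- X j))"
    define py where "py = (2 * (- 2 * k)) *\<^sub>R (Y j + (- (1/2) *\<^sub>R (X j + Z j))) + (2 * 0) *\<^sub>R (Y j + 0)"
    have "local_max_rel \<Omega> (\<lambda>a. u a - (k * (norm (a + (Z j - 2 *\<^sub>R Y j)))\<^sup>2
        + K / 4 * (norm (a + (- Z j)))\<^sup>2)) (X j)"
      unfolding local_max_rel_def
    proof (intro exI[of _ 1] conjI ballI)
      fix a assume "a \<in> \<Omega> \<inter> ball (X j) 1"
      then have "a \<in> closure \<Omega>" using closure_subset by auto
      from mx[OF this cl(2)[of j] cl(3)[of j]]
      show "u a - (k * (norm (a + (Z j - 2 *\<^sub>R Y j)))\<^sup>2 + K / 4 * (norm (a + (- Z j)))\<^sup>2)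
        \<le> u (X j) - (k * (norm (X j + (Z j - 2 *\<^sub>R Y j)))\<^sup>2 + K / 4 * (norm (X j + (- Z j)))\<^sup>2)"
        unfolding add_diff_eq add_uminus_conv_diff by linarith
    qed simp
    then have 1: "u (X j) + H (X j) px \<le> 0"
      unfolding px_def using elim by (intro visc_subsolution_sum_of_squares[OF sub])
    have "local_max_rel \<Omega> (\<lambda>b. u b - (k * (norm (b + (X j - 2 *\<^sub>R Y j)))\<^sup>2
        + K / 4 * (norm (b + (- X j)))\<^sup>2)) (Z j)"
      unfolding local_max_rel_def
    proof (intro exI[of _ 1] conjI ballI)
      fix b assume "b \<in> \<Omega> \<inter> ball (Z j) 1"
      then have "b \<in> closure \<Omega>" using closure_subset by auto
      from mx[OF cl(1)[of j] this cl(3)[of j]]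
      show "u b - (k * (norm (b + (X j - 2 *\<^sub>R Y j)))\<^sup>2 + K / 4 * (norm (b + (- X j)))\<^sup>2)
        \<le> u (Z j) - (k * (norm (Z j + (X j - 2 *\<^sub>R Y j)))\<^sup>2 + K / 4 * (norm (Z j + (- X j)))\<^sup>2)"
        unfolding add_diff_eq add_uminus_conv_diff norm_minus_commute[of _ "X j"]
          add.commute[of _ "X j"] by linarith
    qed simp
    then have 2: "u (Z j) + H (Z j) pz \<le> 0"
      unfolding pz_def using elim by (intro visc_subsolution_sum_of_squares[OF sub])
    have sq: "(norm (X j + Z j - 2 *\<^sub>R c))\<^sup>2 = 4 * (norm (c + (- (1/2) *\<^sub>R (X j + Z j))))\<^sup>2" for c
    proof -
      have "X j + Z j - 2 *\<^sub>R c = (- 2) *\<^sub>R (c + (- (1/2) *\<^sub>R (X j + Z j)))"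
        by (simp add: algebra_simps)
      then show ?thesis by (simp only: norm_scaleR) (simp add: power_mult_distrib)
    qed
    have "local_min_rel (closure \<Omega>) (\<lambda>c. u c - ((- 2 * k) * (norm (c + (- (1/2) *\<^sub>R (X j + Z j))))\<^sup>2
        + 0 * (norm (c + 0))\<^sup>2)) (Y j)"
      unfolding local_min_rel_def
    proof (intro exI[of _ 1] conjI ballI)
      fix c assume "c \<in> closure \<Omega> \<inter> ball (Y j) 1"
      then show "u (Y j) - ((- 2 * k) * (norm (Y j + (- (1/2) *\<^sub>R (X j + Z j))))\<^sup>2 + 0 * (norm (Y j + 0))\<^sup>2)
        \<le> u c - ((- 2 * k) * (norm (c + (- (1/2) *\<^sub>R (X j + Z j))))\<^sup>2 + 0 * (norm (c + 0))\<^sup>2)"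
        using mx[OF cl(1)[of j] cl(2)[of j], of c] unfolding sq by simp
    qed simp
    then have 3: "0 \<le> u (Y j) + H (Y j) py"
      unfolding py_def by (intro visc_supersolution_sum_of_squares[OF super] cl)
    \<comment> \<open>The contributions of \<open>K / 4\<close> to \<open>px\<close> and
      \<open>pz\<close> are opposite and cancel, so \<open>py\<close> is exactly the mean of
      \<open>px\<close> and \<open>pz\<close>.\<close>
    have "px + pz = (4 * k) *\<^sub>R \<zeta>"
      unfolding px_def pz_def \<zeta>_def by (simp add: vec_eq_iff algebra_simps)
    moreover have "py = (2 * k) *\<^sub>R \<zeta>"
      unfolding py_def \<zeta>_def by (simp add: vec_eq_iff algebra_simps)
    ultimately have "py = (1/2) *\<^sub>R (px + pz)" by simp
    then have "2 * G py \<le> G px + G pz" using G by simp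
    then show ?case using 1 2 3 cl by (simp add: H)
  qed
  \<comment> \<open>In the limit the points are \<open>yl + hl\<close>, \<open>yl - hl\<close> and
    \<open>yl\<close>, so semiconcavity of \<open>f\<close> applies and contradicts
    \<open>strict\<close>.\<close>
  have "u xl + u zl - 2 * u yl \<le> f xl + f zl - 2 * f yl"
    by (rule tendsto_le[OF _ _ _ ev]) (auto intro!: tendsto_intros ulim flim)
  then show False using strict conc[OF seg] by (simp add: xzl)
qed

section \<open>From second differences to the Hessian in the viscosity sense\<close>

text \<open>The function \<open>\<psi> t = F t + F (- t) - K * t\<^sup>2\<close> satisfies
  \<open>\<psi>' 0 = 0\<close>, and \<open>\<psi>'\<close> has derivative
  \<open>2 * c - 2 * K\<close> at 0. If this were positive, \<open>\<psi>\<close> would increase to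
  the right of 0, whereas \<open>diff\<close> says \<open>\<psi> t \<le> \<psi> 0\<close>.\<close>

lemma second_derivative_le_of_second_difference_le:
  fixes F :: "real \<Rightarrow> real"
  assumes "0 < r"
    and F: "\<And>t. \<bar>t\<bar> < r \<Longrightarrow> (F has_real_derivative F' t) (at t)"
    and F': "(F' has_real_derivative c) (at 0)"
    and diff: "\<And>t. 0 < t \<Longrightarrow> t < r \<Longrightarrow> F t + F (- t) - 2 * F 0 \<le> K * t\<^sup>2"
  shows "c \<le> K"
proof (rule ccontr)
  assume "\<not> c \<le> K"
  define \<psi> where "\<psi> t = F t + F (- t) - K * t\<^sup>2" for t
  define \<psi>' where "\<psi>' t = F' t - F' (- t) - 2 * K * t" for t
  have F'm: "((\<lambda>t. F' (- t)) has_real_derivative - c) (at 0)"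
    using DERIV_mirror[of F' c 0] F' by simp
  have "(\<psi>' has_real_derivative c - - c - 2 * K) (at 0)"
    unfolding \<psi>'_def by (rule derivative_eq_intros F' F'm refl | simp)+
  moreover have "0 < c - - c - 2 * K" using \<open>\<not> c \<le> K\<close> by simp
  ultimately obtain d where d: "d > 0" "\<And>t. 0 < t \<Longrightarrow> t < d \<Longrightarrow> \<psi>' 0 < \<psi>' (0 + t)"
    using DERIV_pos_inc_right by blast
  have der: "(\<psi> has_real_derivative \<psi>' t) (at t)" if "\<bar>t\<bar> < r" for t
  proof -
    have "((\<lambda>t. F (- t)) has_real_derivative F' (- t) * - 1) (at t)"
      using that by (intro DERIV_chain2[OF F]) (auto intro!: derivative_eq_intros)
    then show ?thesis
      unfolding \<psi>_def \<psi>'_def using F[OF that]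
      by (auto intro!: derivative_eq_intros)
  qed
  define t where "t = min d r / 2"
  have t: "0 < t" "t < d" "t < r" using d(1) assms(1) by (auto simp: t_def)
  have "\<psi> 0 < \<psi> t"
  proof (rule DERIV_pos_imp_increasing_open[OF t(1)])
    fix s assume "0 < s" "s < t"
    then show "\<exists>y. (\<psi> has_real_derivative y) (at s) \<and> 0 < y"
      using der[of s] d(2)[of s] t by (intro exI[of _ "\<psi>' s"]) (auto simp: \<psi>'_def)
  next
    show "continuous_on {0..t} \<psi>"
      using t by (intro continuous_at_imp_continuous_on ballI DERIV_isCont[OF der]) auto
  qed
  then show False using diff[OF t(1,3)] by (simp add: \<psi>_def)
qed

text \<open>A Jacobian represents the derivative once the map is known to be differentiable;
  \<open>Ck_on 2\<close> supplies this for \<open>grad \<phi>\<close> component by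
  component.\<close>

lemma has_derivative_grad:
  assumes "Ck_on 2 S \<phi>" "x \<in> S"
  shows "(grad \<phi> has_derivative (\<lambda>h. hessian \<phi> x *v h)) (at x)"
proof -
  have "Ck_on 1 S (\<lambda>x. grad \<phi> x $ i)" for i
    using assms(1) by (simp add: numeral_2_eq_2)
  then have "\<exists>D. ((\<lambda>x. grad \<phi> x $ i) has_derivative D) (at x)" for i
    using assms(2) by (force simp: gderiv_def)
  then have "(\<lambda>x. grad \<phi> x $ i) differentiable (at x)" for i
    by (simp add: differentiable_def)
  then have "grad \<phi> differentiable (at x)"
    by (simp add: differentiable_componentwise_within[of "grad \<phi>"] Basis_vec_def inner_axis)
  then show ?thesis unfolding hessian_def by (simp add: jacobian_works)
qed

text \<open>At a local minimum of \<open>u - \<phi>\<close> the second differences of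
  \<open>\<phi>\<close> are dominated by those of \<open>u\<close>. Restriction to the line through
  \<open>x\<close> in direction \<open>v\<close> leaves a problem in one variable.\<close>

lemma visc_hessian_le_of_second_difference_le:
  fixes \<Omega> :: "(real^'n) set"
  assumes "open \<Omega>"
    and diff: "\<And>x h. x \<in> \<Omega> \<Longrightarrow> x + h \<in> \<Omega> \<Longrightarrow> x - h \<in> \<Omega> \<Longrightarrow>
        u (x + h) + u (x - h) - 2 * u x \<le> K * (norm h)\<^sup>2"
  shows "visc_hessian_le \<Omega> u K"
  unfolding visc_hessian_le_def matrix_le_def
proof (intro allI impI ballI)
  fix \<phi> x and v :: "real^'n"
  assume "smooth_on \<Omega> \<phi>" and x: "x \<in> \<Omega>" and min: "local_min_rel \<Omega> (\<lambda>y. u y - \<phi> y) x"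
  then have \<phi>: "Ck_on 2 \<Omega> \<phi>" by (simp add: smooth_on_def)
  then have grad: "GDERIV \<phi> y :> grad \<phi> y" if "y \<in> \<Omega>" for y
    using that by (simp add: numeral_2_eq_2)
  obtain r1 where r1: "r1 > 0" "\<And>y. y \<in> \<Omega> \<inter> ball x r1 \<Longrightarrow> u x - \<phi> x \<le> u y - \<phi> y"
    using min unfolding local_min_rel_def by auto
  obtain r2 where r2: "r2 > 0" "ball x r2 \<subseteq> \<Omega>"
    using openE[OF assms(1) x] by metis
  \<comment> \<open>The denominator \<open>norm v + 1\<close> keeps \<open>x + t v\<close> in both
    balls and also admits \<open>v = 0\<close>.\<close>
  define r where "r = min r1 r2 / (norm v + 1)"
  have nv: "norm v + 1 > 0" by (simp add: add_nonneg_pos)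
  have near: "x + t *\<^sub>R v \<in> \<Omega> \<inter> ball x r1" if "\<bar>t\<bar> < r" for t
  proof -
    have "\<bar>t\<bar> * norm v \<le> \<bar>t\<bar> * (norm v + 1)" by (simp add: mult_left_mono)
    also have "\<dots> < min r1 r2" using that nv by (simp add: r_def pos_less_divide_eq)
    finally have "dist x (x + t *\<^sub>R v) < min r1 r2" by (simp add: dist_norm)
    then show ?thesis using r2(2) by auto
  qed
  have "v \<bullet> (hessian \<phi> x *v v) \<le> K * (norm v)\<^sup>2"
  proof (rule second_derivative_le_of_second_difference_le)
    show "0 < r" using r1 r2 nv by (simp add: r_def)
    show "((\<lambda>t. \<phi> (x + t *\<^sub>R v)) has_real_derivative v \<bullet> grad \<phi> (x + t *\<^sub>R v)) (at t)"
      if "\<bar>t\<bar> < r" for t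
    proof -
      have 1: "((\<lambda>t. x + t *\<^sub>R v) has_derivative (\<lambda>h. h *\<^sub>R v)) (at t)"
        by (rule derivative_eq_intros refl | simp)+
      have "(\<phi> has_derivative (\<lambda>h. h \<bullet> grad \<phi> (x + t *\<^sub>R v))) (at (x + t *\<^sub>R v))"
        using grad[of "x + t *\<^sub>R v"] near[OF that] unfolding gderiv_def by simp
      from diff_chain_at[OF 1 this] show ?thesis
        by (simp add: o_def has_field_derivative_def mult_commute_abs)
    qed
    show "((\<lambda>t. v \<bullet> grad \<phi> (x + t *\<^sub>R v)) has_real_derivative v \<bullet> (hessian \<phi> x *v v)) (at 0)"
    proof -
      have 1: "((\<lambda>t. x + t *\<^sub>R v) has_derivative (\<lambda>h. h *\<^sub>R v)) (at 0)"
        by (rule derivative_eq_intros refl | simp)+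
      have "(grad \<phi> has_derivative (\<lambda>h. hessian \<phi> x *v h)) (at (x + 0 *\<^sub>R v))"
        using has_derivative_grad[OF \<phi> x] by simp
      from has_derivative_inner_right[OF diff_chain_at[OF 1 this], of v] show ?thesis
        by (simp add: o_def has_field_derivative_def matrix_vector_mult_scaleR mult_commute_abs)
    qed
    fix t :: real assume t: "0 < t" "t < r"
    have "u x - \<phi> x \<le> u (x + t *\<^sub>R v) - \<phi> (x + t *\<^sub>R v)"
      "u x - \<phi> x \<le> u (x + (- t) *\<^sub>R v) - \<phi> (x + (- t) *\<^sub>R v)"
      using near[of t] near[of "- t"] t by (intro r1(2); simp)+
    moreover have "u (x + t *\<^sub>R v) + u (x - t *\<^sub>R v) - 2 * u x \<le> K * (norm (t *\<^sub>R v))\<^sup>2"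
      using near[of t] near[of "- t"] t by (intro diff x) auto
    ultimately show "\<phi> (x + t *\<^sub>R v) + \<phi> (x + (- t) *\<^sub>R v) - 2 * \<phi> (x + 0 *\<^sub>R v)
        \<le> K * (norm v)\<^sup>2 * t\<^sup>2"
      using t by (simp add: power_mult_distrib mult_ac)
  qed
  then show "v \<bullet> (hessian \<phi> x *v v) \<le> v \<bullet> ((K *\<^sub>R mat 1) *v v)"
    by (simp add: power2_norm_eq_inner scaleR_matrix_vector_assoc[symmetric])
qed

section \<open>Choice of the constant and conclusion\<close>

theorem theorem1p2:
  fixes \<Omega> :: "(real^'n) set"
    and p :: real
    and f :: "real^'n \<Rightarrow> real"
    and Df :: "real^'n \<Rightarrow> real^'n"
    and H :: "real^'n \<Rightarrow> real^'n \<Rightarrow> real"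
  assumes "open \<Omega>" "bounded \<Omega>" "connected \<Omega>" "\<Omega> \<noteq> {}" "C2_boundary \<Omega>"
    and "1 < p" "p \<le> 2"
    and "C1_closure \<Omega> f Df" "semiconcave_in \<Omega> f"
    and "\<And>x \<beta>. x \<in> closure \<Omega> \<Longrightarrow> H x \<beta> = norm \<beta> powr p - f x"
    and "\<forall>x \<in> frontier \<Omega>. f x = (INF y \<in> closure \<Omega>. f y)"
    and "\<forall>x \<in> \<Omega>. f x > (INF y \<in> closure \<Omega>. f y)"
    and "\<exists>C>0. \<forall>x \<in> \<Omega>. norm (Df x) \<le> C * (f x - (INF y \<in> closure \<Omega>. f y)) powr (1 / p)"
  shows "\<exists>C. \<forall>u. constrained_visc_solution \<Omega> H u \<longrightarrow> visc_hessian_le \<Omega> u C"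
proof -
  define m where "m = (INF y \<in> closure \<Omega>. f y)"
  define g where "g y = f y - m" for y
  have f: "continuous_on (closure \<Omega>) f" and Df: "\<And>x. x \<in> \<Omega> \<Longrightarrow> GDERIV f x :> Df x"
    using assms(8) by (auto simp: C1_closure_def)
  have cpt: "compact (closure \<Omega>)" using assms(2) by simp
  obtain Kf where Kf: "Kf \<ge> 0" "\<And>x h. closed_segment (x - h) (x + h) \<subseteq> \<Omega> \<Longrightarrow>
      f (x + h) + f (x - h) - 2 * f x \<le> Kf * (norm h)\<^sup>2"
    using assms(9) unfolding semiconcave_in_def by blast
  obtain C where C: "C > 0" "\<And>x. x \<in> \<Omega> \<Longrightarrow> norm (Df x) \<le> C * g x powr (1 / p)"
    using assms(13) by (auto simp: g_def m_def)
  obtain B where B: "B > 0" "\<And>x. x \<in> closure \<Omega> \<Longrightarrow> norm x \<le> B"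
    using compact_imp_bounded[OF cpt] by (metis bounded_pos)
  have m_le: "m \<le> f x" if "x \<in> closure \<Omega>" for x
    unfolding m_def using compact_imp_bounded[OF compact_continuous_image[OF f cpt]] that
    by (intro cINF_lower bounded_imp_bdd_below)
  define s where "s = 1 - 1 / p"
  \<comment> \<open>This is the conjugate exponent \<open>p / (p - 1)\<close>; the bound
    \<open>p \<le> 2\<close> enters as \<open>s \<le> 1 / 2\<close>, that is
    \<open>2 \<le> q\<close>.\<close>
  define q where "q = 1 / s"
  have s: "0 < s" "s \<le> 1 / 2" using assms(6,7) by (auto simp: s_def field_simps)
  then have q: "2 \<le> q" "s * q = 1" by (auto simp: q_def field_simps)
  have g_dist: "g x powr s \<le> C * dist x w" if "x \<in> closure \<Omega>" "w \<notin> \<Omega>" for x w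
  proof (cases "x \<in> \<Omega>")
    case True
    have g: "continuous_on (closure \<Omega>) g" unfolding g_def by (intro continuous_intros f)
    have Dg: "GDERIV g x :> Df x" if "x \<in> \<Omega>" for x
      using GDERIV_diff[OF Df[OF that] GDERIV_const[of m]] by (simp add: g_def[abs_def])
    show ?thesis
      unfolding s_def using assms(11,12) True that
      by (intro powr_le_dist_complement[OF assms(1,6) C(1) g Dg _ _ C(2)])
        (auto simp: g_def m_def)
  next
    case False
    then have "x \<in> frontier \<Omega>" using that assms(1) by (simp add: frontier_def interior_open)
    then have "g x = 0" using assms(11) by (simp add: g_def m_def)
    then show ?thesis using C(1) by simp
  qed
  \<comment> \<open>The powers come from splitting \<open>(2 * C * t) powr q\<close> into a square
    and a power \<open>q - 2\<close>, the latter bounded through \<open>t \<le> B\<close>. The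
    leading 2 accounts for the two endpoints of a segment, and \<open>2 * C\<close> for their
    distance of at most \<open>2 * norm h\<close> to a point outside
    \<open>\<Omega>\<close>.\<close>
  define K1 where "K1 = 2 * (2 * C)\<^sup>2 * (2 * C * B) powr (q - 2)"
  have g_le: "2 * g x \<le> K1 * t\<^sup>2"
    if "x \<in> closure \<Omega>" "w \<notin> \<Omega>" "dist x w \<le> 2 * t" "t \<le> B" for x w t
  proof (cases "t = 0")
    case True
    then have "x = w" using that by simp
    then have "g x = 0"
      using that assms(1,11) by (simp add: g_def m_def frontier_def interior_open)
    then show ?thesis using True by simp
  next
    case False
    then have t: "t > 0" using that(3) zero_le_dist[of x w] by linarith
    have "0 \<le> g x" using m_le that(1) by (simp add: g_def)
    then have "g x = (g x powr s) powr q" using q by (simp add: powr_powr)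
    also have "\<dots> \<le> (2 * C * t) powr q"
    proof (rule powr_mono2)
      have "g x powr s \<le> C * dist x w" by (rule g_dist[OF that(1,2)])
      also have "\<dots> \<le> C * (2 * t)" using that(3) C(1) by simp
      finally show "g x powr s \<le> 2 * C * t" by simp
    qed (use q in auto)
    also have "\<dots> = (2 * C * t) powr 2 * (2 * C * t) powr (q - 2)"
      by (simp flip: powr_add)
    also have "\<dots> \<le> (2 * C * t) powr 2 * (2 * C * B) powr (q - 2)"
      using that(4) q t C(1) by (intro mult_left_mono powr_mono2) auto
    also have "(2 * C * t) powr 2 = (2 * C)\<^sup>2 * t\<^sup>2"
      using t C(1) by (simp add: power_mult_distrib)
    finally show ?thesis by (simp add: K1_def mult_ac)
  qed
  \<comment> \<open>\<open>Kf\<close> serves segments inside \<open>\<Omega>\<close>,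
    \<open>K1\<close> those that leave it. Both are fixed before \<open>u\<close>, so the constant
    is the same for every solution.\<close>
  define K where "K = max Kf K1"
  have K: "0 \<le> K" "Kf \<le> K" "K1 \<le> K" using Kf(1) by (auto simp: K_def)
  have "visc_hessian_le \<Omega> u K" if "constrained_visc_solution \<Omega> H u" for u
  proof (rule visc_hessian_le_of_second_difference_le[OF assms(1)])
    have u: "continuous_on (closure \<Omega>) u" and sub: "visc_subsolution_in \<Omega> H u"
      and super: "visc_supersolution_closure \<Omega> H u"
      using that by (auto simp: constrained_visc_solution_def)
    have u_le: "u x \<le> f x" if "x \<in> closure \<Omega>" for x
      using that by (intro visc_subsolution_le[OF assms(1) u f sub]) (auto simp: assms(10))
    have u_ge: "m \<le> u x" if "x \<in> closure \<Omega>" for x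
      using that m_le assms(6) by (intro visc_supersolution_ge[OF assms(2) u super]) (auto simp: assms(10))
    fix x h assume "x \<in> \<Omega>" "x + h \<in> \<Omega>" "x - h \<in> \<Omega>"
    then have cl: "x \<in> closure \<Omega>" "x + h \<in> closure \<Omega>" "x - h \<in> closure \<Omega>"
      using closure_subset by auto
    show "u (x + h) + u (x - h) - 2 * u x \<le> K * (norm h)\<^sup>2"
    proof (rule second_difference_le[OF assms(1,2) u f sub super assms(10) _ _ _ K(1) cl])
      show "2 * norm ((1/2) *\<^sub>R (a + b)) powr p \<le> norm a powr p + norm b powr p" for a b :: "real^'n"
        using assms(6) by (intro midpoint_convex_norm_powr) simp
    next
      fix x h assume "closed_segment (x - h) (x + h) \<subseteq> \<Omega>"
      then have "f (x + h) + f (x - h) - 2 * f x \<le> Kf * (norm h)\<^sup>2" by (rule Kf)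
      also have "\<dots> \<le> K * (norm h)\<^sup>2" using K by (intro mult_right_mono) auto
      finally show "f (x + h) + f (x - h) - 2 * f x \<le> K * (norm h)\<^sup>2" .
    next
      fix x h assume x: "x \<in> closure \<Omega>" "x + h \<in> closure \<Omega>" "x - h \<in> closure \<Omega>"
        and "\<not> closed_segment (x - h) (x + h) \<subseteq> \<Omega>"
      then obtain w where w: "w \<in> closed_segment (x - h) (x + h)" "w \<notin> \<Omega>" by blast
      have 2: "(x + h) - (x - h) = 2 *\<^sub>R h" by (simp add: algebra_simps scaleR_2)
      have "dist (x + h) (x - h) = 2 * norm h" unfolding dist_norm 2 by simp
      then have dist: "dist (x + h) w \<le> 2 * norm h" "dist (x - h) w \<le> 2 * norm h"
        using dist_in_closed_segment[OF w(1)] by (auto simp: dist_commute)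
      \<comment> \<open>The vector \<open>2 h\<close> is the difference of two points of the
        closure, hence \<open>norm h\<close> is at most \<open>B\<close>, as \<open>g_le\<close>
        requires.\<close>
      have "norm (2 *\<^sub>R h) \<le> norm (x + h) + norm (x - h)"
        unfolding 2[symmetric] by (rule norm_triangle_ineq4)
      then have "norm h \<le> B" using B(2)[OF x(2)] B(2)[OF x(3)] by simp
      then have "2 * g (x + h) \<le> K1 * (norm h)\<^sup>2" "2 * g (x - h) \<le> K1 * (norm h)\<^sup>2"
        using g_le[OF x(2) w(2) dist(1)] g_le[OF x(3) w(2) dist(2)] by auto
      \<comment> \<open>The constant \<open>m\<close> enters twice from the endpoints and twice from
        the midpoint with opposite sign, leaving \<open>g (x + h) + g (x - h)\<close>.\<close>
      moreover have "u (x + h) \<le> g (x + h) + m" "u (x - h) \<le> g (x - h) + m" "m \<le> u x"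
        using u_le x u_ge by (auto simp: g_def)
      moreover have "K1 * (norm h)\<^sup>2 \<le> K * (norm h)\<^sup>2" using K by (intro mult_right_mono) auto
      ultimately show "u (x + h) + u (x - h) - 2 * u x \<le> K * (norm h)\<^sup>2" by linarith
    qed auto
  qed
  then show ?thesis by blast
qed

end
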